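(* Let $G$ be a finite abelian group of even order, so that $G$ can be written as an internal direct product $G=\langle c\rangle\times A$ for some element $c\in G$ of order $2^k$ with $k\ge 1$ and some subgroup $A<G$; fix such $c$, $k$ and $A$. Let $S\subseteq G$ be closed under inversion and let $\Gamma=\mathrm{Cay}(G,S)$. Let $H=\langle c^2\rangle\times A\le G$. Then $\Gamma$ is a Cayley graph on the generalized dihedral group $\mathrm{Dih}(H)$.
   Context: For a group $G$ and a subset $S\subseteq G$ closed under inversion ($S=S^{-1}$), the Cayley graph $\mathrm{Cay}(G,S)$ is the (undirected) graph with vertex set $G$ in which $u$ and $v$ are adjacent if and only if $v=su$ for some $s\in S$. (The identity is usually omitted from $S$ to avoid loops.) A graph $\Gamma$ is said to be a Cayley graph on a group $K$ if $\Gamma$ is isomorphic to $\mathrm{Cay}(K,T)$ for some inverse-closed $T\subseteq K$; equivalently, $\mathrm{Aut}(\Gamma)$ contains a subgroup isomorphic to $K$ acting regularly on $V(\Gamma)$. For an abelian group $B$, the generalized dihedral group is $\mathrm{Dih}(B)=\langle B,x\rangle$, where $x\notin B$, $x^2=1$ and $bx=xb^{-1}$ for every $b\in B$; that is, the semidirect product of $B$ with a group of order $2$ acting by inversion, so that $B$ has index $2$ in $\mathrm{Dih}(B)$. *)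

theory Defs
  imports "HOL-Algebra.Algebra" "Graph_Theory.Graph_Theory"
begin

text \<open>
  As in the graph library, an undirected graph is a symmetric digraph. Loops are not excluded:
  they occur exactly when the connection set contains the identity.
\<close>

definition cayley_graph :: "('a, 'b) monoid_scheme \<Rightarrow> 'a set \<Rightarrow> 'a pair_pre_digraph" where
  "cayley_graph G S =
     \<lparr>pverts = carrier G,
      parcs = {(u, v). u \<in> carrier G \<and> v \<in> carrier G \<and> (\<exists>s\<in>S. v = s \<otimes>\<^bsub>G\<^esub> u)}\<rparr>"

definition cayley_graph_on :: "'a pair_pre_digraph \<Rightarrow> ('c, 'd) monoid_scheme \<Rightarrow> bool" where
  "cayley_graph_on \<Gamma> K \<longleftrightarrow>
     (\<exists>T \<subseteq> carrier K. set_inv\<^bsub>K\<^esub> T = T \<and> digraph_iso (with_proj \<Gamma>) (with_proj (cayley_graph K T)))"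

definition internal_direct_product :: "('a, 'b) monoid_scheme \<Rightarrow> 'a set \<Rightarrow> 'a set \<Rightarrow> bool" where
  "internal_direct_product G M N \<longleftrightarrow>
     M \<lhd> G \<and> N \<lhd> G \<and> M \<inter> N = {\<one>\<^bsub>G\<^esub>} \<and> M <#>\<^bsub>G\<^esub> N = carrier G"

text \<open>
  The semidirect product of \<open>B\<close> with a group of order 2 acting by inversion: the pair \<open>(b, e)\<close>
  stands for \<open>b\<close> if \<open>e\<close> is false, and for \<open>b x\<close> if \<open>e\<close> is true.
\<close>

definition Dih :: "('a, 'b) monoid_scheme \<Rightarrow> ('a \<times> bool) monoid" where
  "Dih B =
     \<lparr>carrier = carrier B \<times> UNIV,
      monoid.mult = (\<lambda>(a, e) (b, f). (a \<otimes>\<^bsub>B\<^esub> (if e then inv\<^bsub>B\<^esub> b else b), e \<noteq> f)),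
      one = (\<one>\<^bsub>B\<^esub>, False)\<rparr>"

lemma pair_sym_digraph_cayley_graph:
  assumes "group G" "S \<subseteq> carrier G" "set_inv\<^bsub>G\<^esub> S = S"
  shows "pair_sym_digraph (cayley_graph G S)"
proof -
  interpret group G by fact
  have "\<exists>t\<in>S. u = t \<otimes>\<^bsub>G\<^esub> (s \<otimes>\<^bsub>G\<^esub> u)" if "s \<in> S" "u \<in> carrier G" for s u
  proof
    show "inv\<^bsub>G\<^esub> s \<in> S" using that assms(3) by (auto simp: SET_INV_def)
    show "u = inv\<^bsub>G\<^esub> s \<otimes>\<^bsub>G\<^esub> (s \<otimes>\<^bsub>G\<^esub> u)" using that assms(2) by (simp add: inv_solve_left subset_iff)
  qed
  then show ?thesis
    by unfold_locales (auto simp: cayley_graph_def symmetric_def intro!: symI)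
qed

lemma group_Dih:
  assumes "comm_group B"
  shows "group (Dih B)"
proof -
  interpret comm_group B by fact
  show ?thesis
  proof (rule groupI)
    fix p assume "p \<in> carrier (Dih B)"
    then obtain b e where p: "p = (b, e)" "b \<in> carrier B" by (auto simp: Dih_def)
    then show "\<exists>q\<in>carrier (Dih B). q \<otimes>\<^bsub>Dih B\<^esub> p = \<one>\<^bsub>Dih B\<^esub>"
      by (intro bexI[of _ "(if e then b else inv\<^bsub>B\<^esub> b, e)"]) (auto simp: Dih_def)
  qed (auto simp: Dih_def inv_mult m_assoc)
qed

lemma Dih_presentation:
  assumes "comm_group B"
  shows "(\<lambda>b. (b, False)) \<in> hom B (Dih B)"
    and "(\<one>\<^bsub>B\<^esub>, True) \<in> carrier (Dih B)"
    and "(\<one>\<^bsub>B\<^esub>, True) \<otimes>\<^bsub>Dih B\<^esub> (\<one>\<^bsub>B\<^esub>, True) = \<one>\<^bsub>Dih B\<^esub>"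
    and "b \<in> carrier B \<Longrightarrow> (b, False) \<otimes>\<^bsub>Dih B\<^esub> (\<one>\<^bsub>B\<^esub>, True) = (b, True)"
    and "b \<in> carrier B \<Longrightarrow>
           (b, False) \<otimes>\<^bsub>Dih B\<^esub> (\<one>\<^bsub>B\<^esub>, True) = (\<one>\<^bsub>B\<^esub>, True) \<otimes>\<^bsub>Dih B\<^esub> (inv\<^bsub>B\<^esub> b, False)"
proof -
  interpret comm_group B by fact
  show "(\<lambda>b. (b, False)) \<in> hom B (Dih B)"
    and "(\<one>\<^bsub>B\<^esub>, True) \<in> carrier (Dih B)"
    and "(\<one>\<^bsub>B\<^esub>, True) \<otimes>\<^bsub>Dih B\<^esub> (\<one>\<^bsub>B\<^esub>, True) = \<one>\<^bsub>Dih B\<^esub>"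
    and "b \<in> carrier B \<Longrightarrow> (b, False) \<otimes>\<^bsub>Dih B\<^esub> (\<one>\<^bsub>B\<^esub>, True) = (b, True)"
    and "b \<in> carrier B \<Longrightarrow>
           (b, False) \<otimes>\<^bsub>Dih B\<^esub> (\<one>\<^bsub>B\<^esub>, True) = (\<one>\<^bsub>B\<^esub>, True) \<otimes>\<^bsub>Dih B\<^esub> (inv\<^bsub>B\<^esub> b, False)"
    by (auto simp: Dih_def hom_def)
qed

end

theory Submission
  imports Defs
begin

text \<open>
  Since \<open>G\<close> is abelian and \<open>S\<close> is closed under inversion, the map \<open>g \<mapsto> c g\<^sup>-\<^sup>1\<close> is an involutive
  automorphism of the Cayley graph. It interchanges the two cosets of \<open>H\<close>, because \<open>c \<notin> H\<close>, and
  conjugation by it inverts the translations by elements of \<open>H\<close>. Together with these translations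
  it therefore generates a copy of \<open>Dih(H)\<close> that acts regularly on \<open>G\<close>.
\<close>

text \<open>Arcs are pairs of vertices, so a vertex bijection \<open>f\<close> determines the arc
  map as \<open>map_prod f f\<close>, and only the two arc sets remain to be compared.\<close>

lemma digraph_iso_with_projI:
  assumes "parcs \<Gamma> \<subseteq> pverts \<Gamma> \<times> pverts \<Gamma>"
    and "bij_betw f (pverts \<Gamma>) (pverts \<Delta>)"
    and "parcs \<Delta> = map_prod f f ` parcs \<Gamma>"
  shows "digraph_iso (with_proj \<Gamma>) (with_proj \<Delta>)"
proof -
  let ?h = "\<lparr>iso_verts = f, iso_arcs = map_prod f f, iso_head = snd, iso_tail = fst\<rparr>"
  have inj: "inj_on f (pverts \<Gamma>)" and im: "f ` pverts \<Gamma> = pverts \<Delta>"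
    using assms(2) by (auto simp: bij_betw_def)
  have "wf_digraph (with_proj \<Gamma>)"
    using assms(1) by unfold_locales auto
  moreover have "inj_on (map_prod f f) (parcs \<Gamma>)"
    using map_prod_inj_on[OF inj inj] assms(1) by (rule inj_on_subset)
  ultimately have "pre_digraph.digraph_isomorphism (with_proj \<Gamma>) ?h"
    using inj by (simp add: pre_digraph.digraph_isomorphism_def)
  moreover have "with_proj \<Delta> = app_iso ?h (with_proj \<Gamma>)"
    by (simp add: app_iso_def with_proj_def im assms(3))
  ultimately show ?thesis
    unfolding digraph_iso_def by blast
qed

context comm_group
begin

lemma set_inv_eq_imp_inv_mem_iff:
  assumes "S \<subseteq> carrier G" and "set_inv S = S" and "x \<in> carrier G"
  shows "inv x \<in> S \<longleftrightarrow> x \<in> S"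
proof -
  have "inv y \<in> S" if "y \<in> S" for y
    using that assms(2) by (auto simp: SET_INV_def)
  then show ?thesis
    using assms(3) by (metis inv_inv)
qed

text \<open>
  The inverse of the orbit map at the identity of the regular right action in which \<open>(h, False)\<close>
  translates by \<open>h\<close> and \<open>(\<one>, True)\<close> sends \<open>g\<close> to \<open>c \<otimes> inv g\<close>.
\<close>

definition dih_coord :: "'a set \<Rightarrow> 'a \<Rightarrow> 'a \<Rightarrow> 'a \<times> bool" where
  "dih_coord H c g = (if g \<in> H then (g, False) else (c \<otimes> inv g, True))"

text \<open>The product of the two coordinates is found by letting the second act on the point
  \<open>s\<close>. For \<open>u\<close> in \<open>H\<close> it translates \<open>s\<close> to
  \<open>s \<otimes> u\<close>. For \<open>u\<close> outside \<open>H\<close> it translates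
  \<open>s\<close> by \<open>c \<otimes> inv u\<close> and then reflects; the two factors
  \<open>c\<close> cancel and leave \<open>inv s \<otimes> u\<close>.\<close>

lemma
  assumes H: "subgroup H G" and c: "c \<in> carrier G" "c \<notin> H"
    and coset: "\<And>g. g \<in> carrier G \<Longrightarrow> g \<notin> H \<Longrightarrow> c \<otimes> inv g \<in> H"
  shows bij_betw_dih_coord: "bij_betw (dih_coord H c) (carrier G) (carrier (Dih (G\<lparr>carrier := H\<rparr>)))"
    and dih_coord_mult: "\<And>s u. s \<in> carrier G \<Longrightarrow> u \<in> carrier G \<Longrightarrow>
      dih_coord H c s \<otimes>\<^bsub>Dih (G\<lparr>carrier := H\<rparr>)\<^esub> dih_coord H c u =
        dih_coord H c ((if u \<in> H then s else inv s) \<otimes> u)"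
proof -
  interpret H: subgroup H G by fact
  have mult_mem_iff: "h \<otimes> g \<in> H \<longleftrightarrow> g \<in> H" if "h \<in> H" "g \<in> carrier G" for h g
  proof
    assume "h \<otimes> g \<in> H"
    then have "inv h \<otimes> (h \<otimes> g) \<in> H"
      using that(1) by blast
    then show "g \<in> H"
      using that by (simp flip: m_assoc)
  qed (use that in blast)
  have not_mem: "c \<otimes> inv h \<notin> H" if "h \<in> H" for h
    using that c mult_mem_iff[of "inv h" c] by (simp add: m_comm)
  have involution: "c \<otimes> inv (c \<otimes> inv g) = g" if "g \<in> carrier G" for g
    using that c by (simp add: inv_mult m_assoc[symmetric])
  \<comment> \<open>The witness is the orbit map itself. Outside \<open>H\<close> both directions
    use the same formula because the reflection is an involution, and \<open>not_mem\<close> puts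
    its values on \<open>H\<close> outside \<open>H\<close>.\<close>
  show "bij_betw (dih_coord H c) (carrier G) (carrier (Dih (G\<lparr>carrier := H\<rparr>)))"
    by (rule bij_betw_byWitness[where f' = "\<lambda>(h, e). if e then c \<otimes> inv h else h"])
      (auto simp: Dih_def dih_coord_def c coset not_mem involution)
  fix s u assume s: "s \<in> carrier G" and u: "u \<in> carrier G"
  have inv_H: "inv\<^bsub>G\<lparr>carrier := H\<rparr>\<^esub> h = inv h" if "h \<in> H" for h
    using H that by (rule m_inv_consistent)
  show "dih_coord H c s \<otimes>\<^bsub>Dih (G\<lparr>carrier := H\<rparr>)\<^esub> dih_coord H c u =
        dih_coord H c ((if u \<in> H then s else inv s) \<otimes> u)"
  proof (cases "u \<in> H")
    case True
    then have "s \<otimes> u \<in> H \<longleftrightarrow> s \<in> H"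
      using mult_mem_iff[OF True s] s u by (simp add: m_comm)
    then show ?thesis
      using True s u c by (simp add: dih_coord_def Dih_def inv_H inv_mult m_assoc)
  next
    case False
    show ?thesis
    proof (cases "s \<in> H")
      case True
      then show ?thesis
        using False s u c mult_mem_iff[of "inv s" u]
        by (simp add: dih_coord_def Dih_def inv_mult m_lcomm)
    next
      case sF: False
      have "c \<otimes> (inv c \<otimes> u) = u"
        using u c(1) by (simp flip: m_assoc)
      then have eq: "(c \<otimes> inv s) \<otimes> inv (c \<otimes> inv u) = inv s \<otimes> u"
        using s u c(1) by (simp add: inv_mult m_comm[of c "inv s"] m_assoc)
      \<comment> \<open>By \<open>eq\<close>, this quotient of two elements outside \<open>H\<close>
        is also a quotient of their reflections, which \<open>coset\<close> places in
        \<open>H\<close>.\<close>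
      have "inv s \<otimes> u \<in> H"
        using coset[OF s sF] coset[OF u False] eq H.m_closed H.m_inv_closed by metis
      then show ?thesis
        using False sF s u c eq coset[OF u False] by (simp add: dih_coord_def Dih_def inv_H)
    qed
  qed
qed

text \<open>The connection set is the image of \<open>S\<close> under \<open>dih_coord H c\<close>.
  Left multiplication by the image of \<open>s\<close> moves \<open>u\<close> to
  \<open>s \<otimes> u\<close> or to \<open>inv s \<otimes> u\<close>, and which of the two depends
  on \<open>u\<close> alone. As \<open>S\<close> is inverse-closed, every vertex keeps its
  neighbours.\<close>

lemma cayley_graph_on_Dih:
  assumes H: "subgroup H G" and c: "c \<in> carrier G" "c \<notin> H"
    and coset: "\<And>g. g \<in> carrier G \<Longrightarrow> g \<notin> H \<Longrightarrow> c \<otimes> inv g \<in> H"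
    and S: "S \<subseteq> carrier G" "set_inv S = S"
  shows "cayley_graph_on (cayley_graph G S) (Dih (G\<lparr>carrier := H\<rparr>))"
proof -
  define D where "D = Dih (G\<lparr>carrier := H\<rparr>)"
  define f where "f = dih_coord H c"
  interpret H: subgroup H G by fact
  interpret D: group D
    unfolding D_def using H
    by (intro group_Dih group.group_comm_groupI subgroup_imp_group) (auto simp: m_comm)
  note bij = bij_betw_dih_coord[OF H c coset, folded D_def f_def]
  note mult = dih_coord_mult[OF H c coset, folded D_def f_def]
  note inv_iff = set_inv_eq_imp_inv_mem_iff[OF S]
  have inj: "inj_on f (carrier G)" and im: "f ` carrier G = carrier D"
    using bij by (auto simp: bij_betw_def)
  have one: "f \<one> = \<one>\<^bsub>D\<^esub>"
    by (simp add: f_def dih_coord_def D_def Dih_def)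
  \<comment> \<open>An element outside \<open>H\<close> becomes a reflection, which is its own
    inverse; on \<open>H\<close> inversion is that of \<open>G\<close>.\<close>
  have inv_f: "inv\<^bsub>D\<^esub> f s = f (if s \<in> H then inv s else s)" if "s \<in> carrier G" for s
  proof -
    have "f (if s \<in> H then inv s else s) \<otimes>\<^bsub>D\<^esub> f s = \<one>\<^bsub>D\<^esub>"
      using that by (simp add: mult one)
    then show ?thesis
      using that im by (intro D.inv_equality) auto
  qed
  have inv_mem: "inv\<^bsub>D\<^esub> t \<in> f ` S" if "t \<in> f ` S" for t
    using that S(1) by (force simp: inv_f inv_iff subset_iff)
  have T: "f ` S \<subseteq> carrier D"
    using S(1) im by blast
  have "set_inv\<^bsub>D\<^esub> (f ` S) = f ` S"
  proof
    show "set_inv\<^bsub>D\<^esub> (f ` S) \<subseteq> f ` S"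
      unfolding SET_INV_def using inv_mem by blast
    show "f ` S \<subseteq> set_inv\<^bsub>D\<^esub> (f ` S)"
    proof
      fix t assume t: "t \<in> f ` S"
      then have "t = inv\<^bsub>D\<^esub> (inv\<^bsub>D\<^esub> t)" using T by auto
      then show "t \<in> set_inv\<^bsub>D\<^esub> (f ` S)"
        unfolding SET_INV_def using inv_mem[OF t] by blast
    qed
  qed
  moreover have "digraph_iso (with_proj (cayley_graph G S)) (with_proj (cayley_graph D (f ` S)))"
  proof (rule digraph_iso_with_projI)
    have adj: "(\<exists>t\<in>f ` S. f v = t \<otimes>\<^bsub>D\<^esub> f u) \<longleftrightarrow> (\<exists>s\<in>S. v = s \<otimes> u)"
      if u: "u \<in> carrier G" and v: "v \<in> carrier G" for u v
    proof -
      have *: "f v = f s \<otimes>\<^bsub>D\<^esub> f u \<longleftrightarrow> v = (if u \<in> H then s else inv s) \<otimes> u" if "s \<in> S" for s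
        using that S(1) u v inj by (auto simp: mult inj_on_eq_iff subset_iff)
      have "(\<exists>t\<in>f ` S. f v = t \<otimes>\<^bsub>D\<^esub> f u) \<longleftrightarrow> (\<exists>s\<in>S. v = (if u \<in> H then s else inv s) \<otimes> u)"
        by (simp add: *)
      also have "\<dots> \<longleftrightarrow> (\<exists>s\<in>S. v = s \<otimes> u)"
      proof (cases "u \<in> H")
        case False
        have "(\<exists>s\<in>S. v = s \<otimes> u) \<longleftrightarrow> (\<exists>s\<in>set_inv S. v = s \<otimes> u)"
          by (simp add: S(2))
        with False show ?thesis
          by (simp add: SET_INV_def)
      qed simp
      finally show ?thesis .
    qed
    show "parcs (cayley_graph D (f ` S)) = map_prod f f ` parcs (cayley_graph G S)"
    proof -
      \<comment> \<open>Since \<open>f\<close> is onto, the arcs can be pulled back to pairs of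
        vertices of \<open>G\<close>, where \<open>adj\<close> applies.\<close>
      have "parcs (cayley_graph D (f ` S)) =
          map_prod f f ` {(u, v). u \<in> carrier G \<and> v \<in> carrier G \<and> (\<exists>t\<in>f ` S. f v = t \<otimes>\<^bsub>D\<^esub> f u)}"
        unfolding cayley_graph_def im[symmetric] by force
      also have "{(u, v). u \<in> carrier G \<and> v \<in> carrier G \<and> (\<exists>t\<in>f ` S. f v = t \<otimes>\<^bsub>D\<^esub> f u)} =
          parcs (cayley_graph G S)"
        using adj by (auto simp: cayley_graph_def)
      finally show ?thesis .
    qed
  qed (use bij in \<open>auto simp: cayley_graph_def\<close>)
  ultimately show ?thesis
    unfolding cayley_graph_on_def D_def[symmetric] using T by blast
qed

text \<open>Every element is a power of \<open>c\<close> times an element of \<open>A\<close>, and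
  \<open>H\<close> collects those with even exponent. Parity of the exponent is well defined because
  \<open>c\<close> has even order, so \<open>H\<close> has index two and \<open>c\<close> lies in
  the other coset.\<close>

lemma direct_product_double_index_two:
  assumes c: "c \<in> carrier G" and ord: "even (ord c)" and A: "subgroup A G"
    and int: "generate G {c} \<inter> A = {\<one>}" and prod: "generate G {c} <#> A = carrier G"
    and H: "H = generate G {c [^] (2::nat)} <#> A"
  shows "subgroup H G" and "c \<notin> H"
    and "\<And>g. g \<in> carrier G \<Longrightarrow> g \<notin> H \<Longrightarrow> c \<otimes> inv g \<in> H"
proof -
  interpret A: subgroup A G by fact
  have pow2: "(c [^] (2::nat)) [^] i = c [^] (2 * i)" for i :: int
    using c by (simp add: int_pow_pow flip: int_pow_int)
  have gen: "generate G {c} = {c [^] i | i :: int. True}"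
    using c by (simp add: generate_pow)
  have gen2: "generate G {c [^] (2::nat)} = {c [^] (2 * i) | i :: int. True}"
    using c by (simp add: generate_pow pow2)
  have mem_H: "x \<in> H \<longleftrightarrow> (\<exists>i :: int. \<exists>a\<in>A. x = c [^] (2 * i) \<otimes> a)" for x
    unfolding H gen2 set_mult_def by blast
  show "subgroup H G"
    unfolding H using c A by (intro mult_subgroups generate_is_subgroup) auto
  show "c \<notin> H"
  proof
    assume "c \<in> H"
    then obtain i :: int and a where a: "a \<in> A" and eq: "c = c [^] (2 * i) \<otimes> a"
      using mem_H by blast
    \<comment> \<open>Cancelling shows that an odd power of \<open>c\<close> lies in
      \<open>A\<close>, hence is \<open>\<one>\<close>; the even order of \<open>c\<close> would
      then divide an odd number.\<close>
    have "c [^] (1 - 2 * i) = c \<otimes> inv (c [^] (2 * i))"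
      using c by (simp add: int_pow_diff)
    also have "\<dots> = (c [^] (2 * i) \<otimes> a) \<otimes> inv (c [^] (2 * i))"
      using eq by simp
    also have "\<dots> = a"
      using c a by (simp add: m_comm[of "c [^] (2 * i)" a] m_assoc)
    finally have pow: "c [^] (1 - 2 * i) = a" .
    then have "a \<in> generate G {c} \<inter> A"
      using a gen by blast
    then have "c [^] (1 - 2 * i) = \<one>"
      using int pow by simp
    then have "int (ord c) dvd 1 - 2 * i"
      using c by (simp add: int_pow_eq_id)
    moreover have "2 dvd int (ord c)"
      using ord by simp
    ultimately have "2 dvd 1 - 2 * i"
      by (meson dvd_trans)
    then show False
      by presburger
  qed
  fix g assume g: "g \<in> carrier G" "g \<notin> H"
  then obtain i :: int and a where a: "a \<in> A" and eq: "g = c [^] i \<otimes> a"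
    using prod unfolding gen set_mult_def by blast
  have "odd i"
    using g(2) a by (auto simp: eq mem_H elim!: evenE)
  then have "even (1 - i)"
    by simp
  then obtain j where j: "1 - i = 2 * j" ..
  \<comment> \<open>The reflection replaces the exponent \<open>i\<close> by \<open>1 - i\<close>
    and so flips its parity.\<close>
  have "c \<otimes> inv g = c [^] (1 - i) \<otimes> inv a"
    using c a by (simp add: eq inv_mult int_pow_diff m_assoc)
  then show "c \<otimes> inv g \<in> H"
    unfolding j mem_H using a A.m_inv_closed by blast
qed

end

theorem theorem2p3:
  fixes G :: "('a, 'b) monoid_scheme" and c :: 'a and k :: nat and A S H :: "'a set"
  assumes "comm_group G" and "finite (carrier G)" and "even (order G)"
    and "c \<in> carrier G" and "k \<ge> 1" and "group.ord G c = 2 ^ k"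
    and "subgroup A G"
    and "internal_direct_product G (generate G {c}) A"
    and "S \<subseteq> carrier G" and "set_inv\<^bsub>G\<^esub> S = S"
    and "H = generate G {c [^]\<^bsub>G\<^esub> (2::nat)} <#>\<^bsub>G\<^esub> A"
  shows "cayley_graph_on (cayley_graph G S) (Dih (G\<lparr>carrier := H\<rparr>))"
proof -
  interpret comm_group G by fact
  \<comment> \<open>Since \<open>k \<ge> 1\<close>, the order \<open>2 ^ k\<close> of
    \<open>c\<close> is even, which is what keeps \<open>c\<close> out of \<open>H\<close>.\<close>
  have "even (ord c)" and "generate G {c} \<inter> A = {\<one>\<^bsub>G\<^esub>}"
    and "generate G {c} <#>\<^bsub>G\<^esub> A = carrier G"
    using assms by (auto simp: internal_direct_product_def)
  note index_two = direct_product_double_index_two[OF assms(4) this(1) assms(7) this(2,3) assms(11)]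
  show ?thesis
    using index_two assms(4,9,10) by (intro cayley_graph_on_Dih)
qed

end
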